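(* Let $p, q > 0$ be real numbers and let $a$ be a real number with $a \neq -1$. Then $$\int_{0}^{\infty} \left[ \ln(1 + 2a\cos px + a^{2}) - \ln(1 + 2a\cos qx + a^{2}) \right] \frac{dx}{x} = \begin{cases} 2 \ln\left(\frac{q}{p}\right) \ln(1+a) & \text{if } -1 < a \leq 1, \\ 2 \ln\left(\frac{q}{p}\right) \ln\left(1 + \frac{1}{a}\right) & \text{if } a < -1 \text{ or } a \geq 1. \end{cases}$$
   Context: Here $\ln$ is the real natural logarithm. The integral over $(0,\infty)$ is understood as an improper integral, i.e. as the limit of $\int_{\varepsilon}^{R}$ as $\varepsilon \to 0^{+}$ and $R \to \infty$; it need not converge absolutely at infinity. When $a = 1$ the integrand has isolated logarithmic singularities (where $\cos px = -1$ or $\cos qx = -1$), which are locally integrable. The two cases overlap at $a=1$, where both expressions equal $2\ln(q/p)\ln 2$. *)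

theory Defs
  imports "HOL-Analysis.Analysis"
begin

text \<open>
  The improper integral over the open half-line, as the joint limit of the integrals over
  compact subintervals. The integrability clause is needed because \<^const>\<open>integral\<close> is 0 on
  non-integrable functions. The limit is not required to be absolutely convergent at 0
  or at infinity, so this is weaker than integrability over the half-line.
\<close>

definition has_improper_integral_Ioi :: "(real \<Rightarrow> real) \<Rightarrow> real \<Rightarrow> bool" where
  "has_improper_integral_Ioi f I \<longleftrightarrow>
     (\<forall>\<epsilon> R. 0 < \<epsilon> \<and> \<epsilon> \<le> R \<longrightarrow> f absolutely_integrable_on {\<epsilon>..R}) \<and>
     ((\<lambda>(\<epsilon>, R). integral {\<epsilon>..R} f) \<longlongrightarrow> I) (at_right 0 \<times>\<^sub>F at_top)"

end

theory Submission
  imports Defs "HOL-Real_Asymp.Real_Asymp"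
begin

text \<open>
  This is a Frullani integral for $f(t) = \ln(1 + 2a\cos t + a^2)$. Scaling turns the integral
  over $[\varepsilon, R]$ into $\int_{p\varepsilon}^{q\varepsilon} f(t)\,dt/t -
  \int_{pR}^{qR} f(t)\,dt/t$. The first part tends to $f(0)\ln(q/p)$ by continuity, the second to
  $M\ln(q/p)$ where $M$ is the mean of $f$ over a period: $f - M$ has bounded integrals, so the
  second mean value theorem, applied with the monotone weight $1/t$, makes its part vanish.

  For $|a| \le 1$ the mean is $0$ by doubling: with $I(a) = \int_0^{2\pi} f$, multiplying the
  arguments of the logarithms for $a$ and $-a$ gives $2I(a) = I(a) + I(-a) = I(a^2)$. For $a = 1$
  this is $2I(1) = I(1)$, and for $|a| < 1$ iterating it on a bounded family forces $I(a) = 0$.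
  The case $|a| > 1$ reduces to $1/a$ at the cost of the constant $\ln a^2$.
\<close>

section \<open>Periodic functions\<close>

lemma has_integral_periodic_shift:
  fixes f :: "real \<Rightarrow> real"
  assumes "\<And>t. f (t + T) = f t"
  shows "(f has_integral I) {a + T..b + T} \<longleftrightarrow> (f has_integral I) {a..b}"
  using has_integral_shift_real_ivl_iff[of f I "a + T" "b + T" T] assms by simp

lemma periodic_absolutely_integrable:
  fixes f :: "real \<Rightarrow> real"
  assumes per: "\<And>t. f (t + T) = f t" and "T > 0"
    and int: "f absolutely_integrable_on {c..c + T}"
  shows "f absolutely_integrable_on {x..y}"
proof -
  have shift: "f absolutely_integrable_on {a + T..b + T} \<longleftrightarrow> f absolutely_integrable_on {a..b}" for a b
    using has_integral_periodic_shift[of f T _ a b, OF per]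
      has_integral_periodic_shift[of "\<lambda>t. norm (f t)" T _ a b] per
    by (simp add: absolutely_integrable_on_def integrable_on_def)
  have *: "f absolutely_integrable_on {c - real n * T..c + real n * T}" for n
  proof (induction n)
    case 0
    then show ?case
      using absolutely_integrable_on_subinterval[OF int, of c c] \<open>T > 0\<close> by simp
  next
    case (Suc n)
    define d where "d = real n * T"
    have d: "d \<ge> 0" using \<open>T > 0\<close> by (simp add: d_def)
    have IH: "f absolutely_integrable_on {c - d..c + d}" using Suc by (simp add: d_def)
    have "f absolutely_integrable_on {c - d + T..c + d + T}" using IH by (simp only: shift)
    moreover have "f absolutely_integrable_on {c - d - T..c + d - T}"
      using IH shift[of "c - d - T" "c + d - T"] by simp
    moreover have "f absolutely_integrable_on {c - T..c}"
      using int shift[of "c - T" c] by simp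
    \<comment> \<open>For n \<ge> 1 the translates by T and -T of the previous interval both reach c
      and cover the next one. For n = 0 they are single points, and the two full periods next to c
      do the covering.\<close>
    ultimately have "f absolutely_integrable_on
        (({c - d - T..c + d - T} \<union> {c - T..c}) \<union> ({c..c + T} \<union> {c - d + T..c + d + T}))"
      by (intro absolutely_integrable_Un int)
    moreover have "{c - real (Suc n) * T..c + real (Suc n) * T} \<subseteq>
        (({c - d - T..c + d - T} \<union> {c - T..c}) \<union> ({c..c + T} \<union> {c - d + T..c + d + T}))"
    proof (cases "n = 0")
      case False
      then have "1 * T \<le> real n * T" using \<open>T > 0\<close> by (intro mult_right_mono) auto
      then show ?thesis using \<open>T > 0\<close> by (auto simp: d_def algebra_simps)
    qed (auto simp: d_def)
    ultimately show ?case
      by (rule absolutely_integrable_on_subinterval)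
  qed
  obtain n where n: "real n > (\<bar>x\<bar> + \<bar>y\<bar> + \<bar>c\<bar>) / T"
    using reals_Archimedean2 by blast
  then have "real n * T > \<bar>x\<bar> + \<bar>y\<bar> + \<bar>c\<bar>"
    using \<open>T > 0\<close> by (simp add: field_simps)
  then have "{x..y} \<subseteq> {c - real n * T..c + real n * T}"
    by auto
  with * show ?thesis
    by (rule absolutely_integrable_on_subinterval)
qed

text \<open>For x \<le> y, each side arises from the integral over \<open>{x..y + T}\<close> by
  removing \<open>{x..y}\<close> or its translate by T, and these two pieces have equal
  integrals.\<close>

lemma periodic_integral_eq:
  fixes f :: "real \<Rightarrow> real"
  assumes per: "\<And>t. f (t + T) = f t" and "T > 0"
    and int: "\<And>x y. f integrable_on {x..y}"
  shows "integral {x..x + T} f = integral {y..y + T} f"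
proof -
  have *: "integral {x..x + T} f = integral {y..y + T} f" if "x \<le> y" for x y
  proof -
    have "integral {x..x + T} f + integral {x + T..y + T} f = integral {x..y + T} f"
      by (rule Henstock_Kurzweil_Integration.integral_combine) (use that \<open>T > 0\<close> int in auto)
    moreover have "integral {x..y} f + integral {y..y + T} f = integral {x..y + T} f"
      by (rule Henstock_Kurzweil_Integration.integral_combine) (use that \<open>T > 0\<close> int in auto)
    moreover have "(f has_integral integral {x..y} f) {x + T..y + T}"
      using has_integral_periodic_shift[of f T _ x y, OF per] int by blast
    then have "integral {x + T..y + T} f = integral {x..y} f"
      by (rule integral_unique)
    ultimately show ?thesis by simp
  qed
  show ?thesis using *[of x y] *[of y x] by linarith
qed

text \<open>Whole periods contribute nothing, so only a remainder lying inside one period counts.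
  This provides the constant B in \<open>frullani\<close>.\<close>

lemma periodic_mean_zero_integral_bound:
  fixes g :: "real \<Rightarrow> real"
  assumes per: "\<And>t. g (t + T) = g t" and "T > 0"
    and int: "\<And>x y. g absolutely_integrable_on {x..y}"
    and mean: "integral {0..T} g = 0"
    and "x \<le> y"
  shows "\<bar>integral {x..y} g\<bar> \<le> integral {0..T} (\<lambda>t. \<bar>g t\<bar>)"
proof -
  have intg: "g integrable_on {x..y}" and intn: "(\<lambda>t. \<bar>g t\<bar>) integrable_on {x..y}" for x y
    using int[of x y] by (auto simp: absolutely_integrable_on_def)
  have zero: "integral {x..x + real n * T} g = 0" for n
  proof (induction n)
    case (Suc n)
    have "integral {x..x + real n * T} g + integral {x + real n * T..x + real n * T + T} g
        = integral {x..x + real n * T + T} g"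
      by (rule Henstock_Kurzweil_Integration.integral_combine) (use \<open>T > 0\<close> intg in auto)
    moreover have "integral {x + real n * T..x + real n * T + T} g = 0"
      using periodic_integral_eq[of g T "x + real n * T" 0] per \<open>T > 0\<close> intg mean by simp
    ultimately show ?case using Suc by (simp add: algebra_simps)
  qed simp
  define n where "n = nat \<lfloor>(y - x) / T\<rfloor>"
  define z where "z = x + real n * T"
  have "(y - x) / T \<ge> 0" using \<open>x \<le> y\<close> \<open>T > 0\<close> by simp
  then have "real n \<le> (y - x) / T" "(y - x) / T < real n + 1"
    unfolding n_def by linarith+
  then have z: "x \<le> z" "z \<le> y" "y \<le> z + T"
    using \<open>T > 0\<close> by (auto simp: z_def field_simps)
  have "integral {x..z} g + integral {z..y} g = integral {x..y} g"
    by (rule Henstock_Kurzweil_Integration.integral_combine) (use z intg in auto)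
  then have "integral {x..y} g = integral {z..y} g"
    using zero[of n] by (simp add: z_def)
  also have "\<bar>\<dots>\<bar> \<le> integral {z..y} (\<lambda>t. \<bar>g t\<bar>)"
    using integral_norm_bound_integral[OF intg intn] by simp
  also have "\<dots> \<le> integral {z..z + T} (\<lambda>t. \<bar>g t\<bar>)"
    by (rule integral_subset_le) (use z intn in auto)
  also have "\<dots> = integral {0..T} (\<lambda>t. \<bar>g t\<bar>)"
    using periodic_integral_eq[of "\<lambda>t. \<bar>g t\<bar>" T z 0] per \<open>T > 0\<close> intn by simp
  finally show ?thesis .
qed

section \<open>The logarithmic kernel\<close>

text \<open>The argument of \<open>ln\<close> is the squared modulus of 1 + a e^(it). It vanishes
  only for |a| = 1 with a cos t = -1, and there the value is \<open>ln 0 = 0\<close>.\<close>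

definition log_cos :: "real \<Rightarrow> real \<Rightarrow> real" where
  "log_cos a t = ln (1 + 2 * a * cos t + a\<^sup>2)"

lemma log_cos_periodic: "log_cos a (t + 2 * pi) = log_cos a t"
  by (simp add: log_cos_def)

lemma log_cos_minus_left: "log_cos (- a) t = log_cos a (t + pi)"
  by (simp add: log_cos_def)

lemma log_cos_arg_ge:
  fixes a t :: real
  shows "(1 - \<bar>a\<bar>)\<^sup>2 \<le> 1 + 2 * a * cos t + a\<^sup>2"
proof -
  have "\<bar>a * cos t\<bar> \<le> \<bar>a\<bar> * 1"
    unfolding abs_mult by (intro mult_left_mono) auto
  then show ?thesis
    by (simp add: power2_eq_square algebra_simps abs_if split: if_splits)
qed

lemma log_cos_arg_pos:
  fixes a t :: real
  assumes "\<bar>a\<bar> \<noteq> 1 \<or> \<bar>cos t\<bar> \<noteq> 1"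
  shows "1 + 2 * a * cos t + a\<^sup>2 > 0"
proof (cases "\<bar>a\<bar> = 1")
  case False
  then have "0 < (1 - \<bar>a\<bar>)\<^sup>2" by simp
  also note log_cos_arg_ge
  finally show ?thesis .
next
  case True
  then have "\<bar>cos t\<bar> < 1" using assms abs_cos_le_one[of t] by linarith
  then show ?thesis using True by (auto simp: abs_if split: if_splits)
qed

section \<open>Integrability across the logarithmic singularities\<close>

lemma log_cos_absolutely_integrable_neg_one_near_zero:
  obtains d where "d > 0" "d < 1" "log_cos (- 1) absolutely_integrable_on {0..d}"
proof -
  \<comment> \<open>With a = -1 the singularity sits at 0. The argument 2 - 2 cos t behaves like
    t^2, so the kernel behaves like 2 ln t: it is negative and dominated by the integrable
    \<open>t powr (-1/2)\<close>.\<close>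
  have "eventually (\<lambda>t::real. ln (1 + 2 * (-1) * cos t + (-1)\<^sup>2) < 0) (at_right 0)"
    by real_asymp
  moreover have "eventually (\<lambda>t::real. - (t powr (-1/2)) \<le> ln (1 + 2 * (-1) * cos t + (-1)\<^sup>2)) (at_right 0)"
    by real_asymp
  ultimately have "eventually (\<lambda>t::real. \<bar>log_cos (-1) t\<bar> \<le> t powr (-1/2)) (at_right 0)"
    unfolding log_cos_def by eventually_elim linarith
  then obtain b where b: "b > 0" "\<And>t. 0 < t \<Longrightarrow> t < b \<Longrightarrow> \<bar>log_cos (-1) t\<bar> \<le> t powr (-1/2)"
    unfolding eventually_at_right_field by auto
  define d where "d = min b 1 / 2"
  have d: "0 < d" "d < b" "d < 1" using b(1) by (auto simp: d_def)
  have "log_cos (-1) absolutely_integrable_on {0..d}"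
  proof (rule measurable_bounded_by_integrable_imp_absolutely_integrable)
    show "log_cos (-1) \<in> borel_measurable (lebesgue_on {0..d})"
      unfolding log_cos_def by (intro measurable_restrict_space1 measurable_completion) measurable
    show "(\<lambda>t. t powr (-1/2)) integrable_on {0..d}"
      using has_integral_powr_from_0[of "-1/2" d] d by (auto simp: integrable_on_def)
    \<comment> \<open>At t = 0 both sides are 0, since \<open>ln 0 = 0\<close> and
      \<open>0 powr (-1/2) = 0\<close>.\<close>
    show "norm (log_cos (-1) t) \<le> t powr (-1/2)" if "t \<in> {0..d}" for t
      using b(2)[of t] that d by (cases "t = 0") (auto simp: log_cos_def)
  qed auto
  with d that show ?thesis by blast
qed

lemma log_cos_continuous_on:
  assumes "\<And>t. t \<in> S \<Longrightarrow> \<bar>a\<bar> \<noteq> 1 \<or> \<bar>cos t\<bar> \<noteq> 1"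
  shows "continuous_on S (log_cos a)"
  unfolding log_cos_def
  by (intro continuous_intros) (use assms log_cos_arg_pos in force)

text \<open>The period from -d to 2 pi - d has its only singularity at 0: the right side of 0 is
  known, the left side follows by evenness, and the kernel is continuous on the rest. Periodicity
  extends this to all intervals.\<close>

lemma log_cos_absolutely_integrable_neg_one: "log_cos (-1) absolutely_integrable_on {x..y}"
proof -
  obtain d where d: "d > 0" "d < 1" and int: "log_cos (- 1) absolutely_integrable_on {0..d}"
    by (rule log_cos_absolutely_integrable_neg_one_near_zero)
  have "continuous_on {d..2 * pi - d} (log_cos (-1))"
    unfolding log_cos_def
  proof (intro continuous_intros ballI)
    fix t assume t: "t \<in> {d..2 * pi - d}"
    have "cos t \<noteq> 1"
    proof
      assume "cos t = 1"
      then obtain n :: int where n: "t = of_int n * 2 * pi" using cos_one_2pi_int by auto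
      have "0 < t" "t < 2 * pi" using t d by auto
      then have "0 < of_int n * (2 * pi)" "of_int n * (2 * pi) < 1 * (2 * pi)"
        unfolding n by (simp_all only: mult.assoc mult_1_left)
      then have "0 < real_of_int n" "real_of_int n < 1"
        by (simp_all only: zero_less_mult_iff mult_less_cancel_right) auto
      then show False by simp
    qed
    then show "1 + 2 * - 1 * cos t + (- 1)\<^sup>2 \<noteq> 0" by simp
  qed
  then have mid: "log_cos (-1) absolutely_integrable_on {d..2 * pi - d}"
    by (rule absolutely_integrable_continuous_real)
  have even: "(\<lambda>t. log_cos (-1) (- t)) = log_cos (-1)" by (simp add: log_cos_def fun_eq_iff)
  have "log_cos (-1) absolutely_integrable_on {-d..-0}"
    using absolutely_integrable_reflect_real[where f = "log_cos (-1)" and a = 0 and b = d] int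
    by (simp only: even)
  then have "log_cos (-1) absolutely_integrable_on ({-d..-0} \<union> ({0..d} \<union> {d..2 * pi - d}))"
    by (intro absolutely_integrable_Un int mid)
  then have period: "log_cos (-1) absolutely_integrable_on {-d..-d + 2 * pi}"
    by (rule absolutely_integrable_on_subinterval) auto
  show ?thesis
    by (rule periodic_absolutely_integrable[OF log_cos_periodic _ period]) simp
qed

lemma log_cos_absolutely_integrable: "log_cos a absolutely_integrable_on {x..y}"
proof (cases "\<bar>a\<bar> = 1")
  case False
  then show ?thesis
    by (intro absolutely_integrable_continuous_real log_cos_continuous_on) auto
next
  case True
  \<comment> \<open>The kernel for a = 1 is the one for a = -1 shifted by pi, so integrability of it
    and of its norm carries over.\<close>
  have eq: "(\<lambda>t. log_cos (-1) (t + pi)) = log_cos 1"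
    by (simp add: log_cos_def fun_eq_iff)
  have "log_cos 1 absolutely_integrable_on {x..y}"
    using log_cos_absolutely_integrable_neg_one[of "x + pi" "y + pi"]
      integrable_shift_real_ivl[of "log_cos (-1)" "x + pi" "y + pi" pi]
      integrable_shift_real_ivl[of "\<lambda>t. norm (log_cos (-1) t)" "x + pi" "y + pi" pi]
    unfolding absolutely_integrable_on_def
    by (simp add: eq fun_cong[OF eq])
  with True log_cos_absolutely_integrable_neg_one show ?thesis
    by (auto simp: abs_if split: if_splits)
qed

lemma log_cos_integrable: "log_cos a integrable_on {x..y}"
  using log_cos_absolutely_integrable by (auto simp: absolutely_integrable_on_def)

section \<open>The integral of the kernel over a period\<close>

lemma log_cos_integral_period: "integral {x..x + 2 * pi} (log_cos a) = integral {0..2 * pi} (log_cos a)"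
  using periodic_integral_eq[of "log_cos a" "2 * pi" x 0] log_cos_periodic log_cos_integrable by simp

lemma log_cos_integral_minus:
  "integral {0..2 * pi} (log_cos (- a)) = integral {0..2 * pi} (log_cos a)"
proof -
  have "integral {0..2 * pi} (log_cos (- a)) = integral {pi..pi + 2 * pi} (log_cos a)"
    using integral_shift_real_ivl[of pi pi "pi + 2 * pi" "log_cos a"]
    by (simp add: log_cos_minus_left[abs_def])
  then show ?thesis by (simp only: log_cos_integral_period)
qed

text \<open>If \<open>sin t = 0\<close> and \<open>\<bar>a\<bar> = 1\<close>, one of the logarithms is the junk value \<open>ln 0 = 0\<close> and the
  identity fails.\<close>

lemma log_cos_add_minus:
  assumes "sin t \<noteq> 0"
  shows "log_cos a t + log_cos (- a) t = log_cos (- a\<^sup>2) (2 * t)"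
proof -
  have c: "\<bar>cos t\<bar> \<noteq> 1"
  proof
    assume "\<bar>cos t\<bar> = 1"
    then have "(cos t)\<^sup>2 = 1" by (metis power2_abs one_power2)
    then show False using assms sin_cos_squared_add[of t] by simp
  qed
  \<comment> \<open>The product is (1 + a^2)^2 - 4 a^2 cos^2 t, and cos 2t = 2 cos^2 t - 1 makes it
    the argument for -a^2 at 2t.\<close>
  have "(1 + 2 * a * cos t + a\<^sup>2) * (1 + 2 * - a * cos t + (- a)\<^sup>2)
      = 1 + 2 * (- a\<^sup>2) * (2 * (cos t)\<^sup>2 - 1) + (- a\<^sup>2)\<^sup>2"
    by (simp add: power2_eq_square algebra_simps)
  moreover have "ln (1 + 2 * a * cos t + a\<^sup>2) + ln (1 + 2 * - a * cos t + (- a)\<^sup>2)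
      = ln ((1 + 2 * a * cos t + a\<^sup>2) * (1 + 2 * - a * cos t + (- a)\<^sup>2))"
    by (intro ln_mult_pos[symmetric] log_cos_arg_pos disjI2 c)
  ultimately show ?thesis
    unfolding log_cos_def cos_double_cos by simp
qed

text \<open>Integrate \<open>log_cos_add_minus\<close>: the substitution of 2t runs through two
  periods with weight 1/2, which gives one period integral again. Changing the sign of a parameter
  does not affect that integral.\<close>

lemma log_cos_integral_double:
  "2 * integral {0..2 * pi} (log_cos a) = integral {0..2 * pi} (log_cos (a\<^sup>2))"
proof -
  define J where "J = integral {0..2 * pi} (log_cos (- a\<^sup>2))"
  have "integral {0..2 * pi} (log_cos (- a\<^sup>2)) + integral {2 * pi..4 * pi} (log_cos (- a\<^sup>2))
      = integral {0..4 * pi} (log_cos (- a\<^sup>2))"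
    by (rule Henstock_Kurzweil_Integration.integral_combine) (auto simp: log_cos_integrable)
  then have "integral {0..4 * pi} (log_cos (- a\<^sup>2)) = 2 * J"
    using log_cos_integral_period[of "2 * pi"] by (simp add: J_def)
  then have "(log_cos (- a\<^sup>2) has_integral 2 * J) {0..4 * pi}"
    using log_cos_integrable by (metis integrable_integral)
  then have "((\<lambda>t. log_cos (- a\<^sup>2) (2 * t)) has_integral J) ((\<lambda>x. x / 2) ` {0..4 * pi})"
    using has_integral_stretch_real[of _ "2 * J" 0 "4 * pi" 2] by simp
  moreover have "(\<lambda>x. x / 2) ` {0..4 * pi} = {0..2 * pi}"
    by (simp add: image_divide_atLeastAtMost)
  ultimately have 1: "((\<lambda>t. log_cos (- a\<^sup>2) (2 * t)) has_integral J) {0..2 * pi}"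
    by simp
  have "((\<lambda>t. log_cos a t + log_cos (- a) t) has_integral J) {0..2 * pi}"
  \<comment> \<open>The excluded points are the zeros of \<open>sin\<close> in the period, where the
    pointwise identity may fail.\<close>
  proof (rule has_integral_spike_finite[OF _ _ 1, of "{0, pi, 2 * pi}"])
    fix t assume t: "t \<in> {0..2 * pi} - {0, pi, 2 * pi}"
    have "sin t \<noteq> 0"
    proof
      assume "sin t = 0"
      then obtain n :: int where n: "t = of_int n * pi" using sin_zero_iff_int2 by auto
      have "0 < t" "t < 2 * pi" using t by auto
      then have "0 < of_int n * pi" "of_int n * pi < 2 * pi" unfolding n .
      then have "0 < real_of_int n" "real_of_int n < 2"
        by (simp_all only: zero_less_mult_iff mult_less_cancel_right) auto
      then have "n = 1" by linarith
      then show False using t n by simp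
    qed
    then show "log_cos a t + log_cos (- a) t = log_cos (- a\<^sup>2) (2 * t)"
      by (rule log_cos_add_minus)
  qed simp
  then have "integral {0..2 * pi} (log_cos a) + integral {0..2 * pi} (log_cos (- a)) = J"
    using integral_unique Henstock_Kurzweil_Integration.integral_add[OF log_cos_integrable log_cos_integrable]
    by metis
  then show ?thesis by (simp only: log_cos_integral_minus J_def)
qed

text \<open>The bound is uniform over |b| \<le> r, as the iteration in
  \<open>log_cos_integral_zero\<close> replaces b by b^2. The argument lies between (1 - r)^2 and (1
  + r)^2, and (1 - r)(1 + r) \<le> 1 lets - 2 ln (1 - r) serve for both ends.\<close>

lemma log_cos_integral_bound:
  assumes "\<bar>b\<bar> \<le> r" "r < 1"
  shows "\<bar>integral {0..2 * pi} (log_cos b)\<bar> \<le> - 2 * ln (1 - r) * (2 * pi)"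
proof -
  have "\<bar>log_cos b t\<bar> \<le> - 2 * ln (1 - r)" for t
  proof -
    have r: "0 \<le> r" using assms by linarith
    have up: "1 + 2 * b * cos t + b\<^sup>2 \<le> (1 + r)\<^sup>2"
    proof -
      have "\<bar>b * cos t\<bar> \<le> r * 1"
        unfolding abs_mult by (intro mult_mono) (use assms r in auto)
      moreover have "b\<^sup>2 \<le> r\<^sup>2" using assms by (simp add: abs_le_square_iff[symmetric])
      ultimately show ?thesis by (simp add: power2_eq_square algebra_simps) 
    qed
    have "(1 - r)\<^sup>2 \<le> (1 - \<bar>b\<bar>)\<^sup>2" using assms by (intro power_mono) auto
    with log_cos_arg_ge[of b t] have lo: "(1 - r)\<^sup>2 \<le> 1 + 2 * b * cos t + b\<^sup>2" by linarith
    have "(1 - r)\<^sup>2 > 0" using assms by simp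
    with lo up have "ln ((1 - r)\<^sup>2) \<le> log_cos b t" "log_cos b t \<le> ln ((1 + r)\<^sup>2)"
      unfolding log_cos_def by (intro ln_mono; linarith)+
    moreover have "ln (1 - r) + ln (1 + r) \<le> 0"
    proof -
      have "(1 - r) * (1 + r) \<le> 1" using r by (simp add: algebra_simps)
      moreover have "ln (1 - r) + ln (1 + r) = ln ((1 - r) * (1 + r))"
        using assms r by (simp add: ln_mult)
      ultimately show ?thesis using assms r by simp
    qed
    ultimately show ?thesis using assms r by (simp add: ln_realpow)
  qed
  then have "norm (integral {0..2 * pi} (log_cos b)) \<le> integral {0..2 * pi} (\<lambda>t::real. - 2 * ln (1 - r))"
    by (intro integral_norm_bound_integral log_cos_integrable) auto
  then show ?thesis by (simp add: mult_ac)
qed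

lemma log_cos_integral_zero:
  assumes "\<bar>a\<bar> \<le> 1"
  shows "integral {0..2 * pi} (log_cos a) = 0"
proof (cases "\<bar>a\<bar> = 1")
  case True
  have "2 * integral {0..2 * pi} (log_cos 1) = integral {0..2 * pi} (log_cos 1)"
    using log_cos_integral_double[of 1] by simp
  then show ?thesis
    using True log_cos_integral_minus[of 1] by (auto simp: abs_if split: if_splits)
next
  case False
  define r where "r = \<bar>a\<bar>"
  define C where "C = - 2 * ln (1 - r) * (2 * pi)"
  have r: "0 \<le> r" "r < 1" using False assms by (auto simp: r_def)
  \<comment> \<open>Since r < 1, the range |b| \<le> r is stable under squaring, and each use of the
    doubling formula halves the bound.\<close>
  have *: "\<bar>integral {0..2 * pi} (log_cos b)\<bar> \<le> C / 2 ^ n" if "\<bar>b\<bar> \<le> r" for n b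
    using that
  proof (induction n arbitrary: b)
    case 0
    then show ?case using log_cos_integral_bound[of b r] r by (simp add: C_def)
  next
    case (Suc n)
    have "\<bar>b\<bar> * \<bar>b\<bar> \<le> r * 1" using Suc.prems r by (intro mult_mono) auto
    then have "\<bar>b\<^sup>2\<bar> \<le> r" by (simp add: power2_eq_square)
    from Suc.IH[OF this] log_cos_integral_double[of b, symmetric] show ?case
      by (simp add: field_simps)
  qed
  have "(\<lambda>n. C / 2 ^ n) \<longlonglongrightarrow> 0" by real_asymp
  then have "\<bar>integral {0..2 * pi} (log_cos a)\<bar> \<le> 0"
    by (rule LIMSEQ_le_const) (use *[of a] in \<open>auto simp: r_def\<close>)
  then show ?thesis by simp
qed

section \<open>Frullani integrals with a mean value at infinity\<close>

lemma has_integral_inverse_Icc: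
  fixes u v :: real
  assumes "0 < u" "u \<le> v"
  shows "((\<lambda>t. 1 / t) has_integral ln (v / u)) {u..v}"
proof -
  have "((\<lambda>t. 1 / t) has_integral (ln v - ln u)) {u..v}"
    by (rule fundamental_theorem_of_calculus)
       (use assms in \<open>auto intro!: derivative_eq_intros
          simp flip: has_real_derivative_iff_has_vector_derivative simp: field_simps\<close>)
  then show ?thesis using assms by (simp add: ln_div)
qed

lemma absolutely_integrable_divide_Icc:
  fixes f :: "real \<Rightarrow> real"
  assumes "f absolutely_integrable_on {u..v}" "0 < u"
  shows "(\<lambda>t. f t / t) absolutely_integrable_on {u..v}"
proof -
  have cont: "continuous_on {u..v} (\<lambda>t. 1 / t)"
    by (intro continuous_intros) (use \<open>0 < u\<close> in auto)
  have "(\<lambda>t. 1 / t * f t) absolutely_integrable_on {u..v}"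
  proof (rule absolutely_integrable_bounded_measurable_product_real)
    show "(\<lambda>t. 1 / t) \<in> borel_measurable (lebesgue_on {u..v})"
      by (intro measurable_restrict_space1 measurable_completion) measurable
    show "bounded ((\<lambda>t. 1 / t) ` {u..v})"
      using cont by (intro compact_imp_bounded compact_continuous_image) auto
  qed (use assms in auto)
  then show ?thesis by simp
qed

text \<open>Bounded integrals of g against the monotone weight 1/t decay like 1/u, even though g
  itself need not decay.\<close>

lemma integral_divide_bound:
  fixes g :: "real \<Rightarrow> real"
  assumes int: "g integrable_on {u..v}" and "0 < u" "u \<le> v"
    and B: "\<And>x y. x \<le> y \<Longrightarrow> \<bar>integral {x..y} g\<bar> \<le> B"
  shows "\<bar>integral {u..v} (\<lambda>t. g t / t)\<bar> \<le> 2 * B / u"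
proof -
  \<comment> \<open>the weight is \<open>- 1 / t\<close> because the second mean value theorem asks for a nondecreasing one\<close>
  have "- (1 / x) \<le> - (1 / y)" if "u \<le> x" "x \<le> y" for x y
    using that \<open>0 < u\<close> by (simp add: frac_le)
  then obtain c where c: "c \<in> {u..v}"
    and eq: "integral {u..v} (\<lambda>t. - (1 / t) * g t)
        = - (1 / u) * integral {u..c} g + - (1 / v) * integral {c..v} g"
    using second_mean_value_theorem[OF int \<open>u \<le> v\<close>, of "\<lambda>t. - (1 / t)"] by metis
  have "integral {u..v} (\<lambda>t. - (1 / t) * g t) = - integral {u..v} (\<lambda>t. g t / t)"
    by (simp flip: integral_neg)
  with eq have "integral {u..v} (\<lambda>t. g t / t) = integral {u..c} g / u + integral {c..v} g / v"
    by simp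
  also have "\<bar>\<dots>\<bar> \<le> B / u + B / v"
  proof -
    have "\<bar>integral {u..c} g / u\<bar> \<le> B / u" "\<bar>integral {c..v} g / v\<bar> \<le> B / v"
      using B[of u c] B[of c v] c assms(2,3) by (simp_all add: divide_right_mono)
    then show ?thesis by linarith
  qed
  \<comment> \<open>The instance of the bound on \<open>{u..u}\<close> shows B \<ge> 0, which is
    needed to pass from B / v to B / u.\<close>
  also have "\<dots> \<le> B / u + B / u"
    using assms(2,3) B[of u u] by (intro add_left_mono frac_le) auto
  finally show ?thesis by simp
qed

lemma has_improper_integral_Ioi_uminus:
  assumes "has_improper_integral_Ioi f I"
  shows "has_improper_integral_Ioi (\<lambda>x. - f x) (- I)"
proof -
  have "((\<lambda>z. - (case z of (\<epsilon>, R) \<Rightarrow> integral {\<epsilon>..R} f)) \<longlongrightarrow> - I) (at_right 0 \<times>\<^sub>F at_top)"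
    using assms unfolding has_improper_integral_Ioi_def by (intro tendsto_minus) auto
  also have "(\<lambda>z. - (case z of (\<epsilon>, R) \<Rightarrow> integral {\<epsilon>..R} f)) = (\<lambda>(\<epsilon>, R). integral {\<epsilon>..R} (\<lambda>x. - f x))"
    by (auto simp: fun_eq_iff)
  finally show ?thesis
    using assms unfolding has_improper_integral_Ioi_def by (auto simp: absolutely_integrable_on_def intro: integrable_neg)
qed

text \<open>Scale invariance of dt/t: the factor 1/c of the substitution t = c x cancels against the
  divisor.\<close>

lemma has_integral_scale_divide:
  fixes f :: "real \<Rightarrow> real"
  assumes "((\<lambda>t. f t / t) has_integral I) {c * u..c * v}" "c > 0"
  shows "((\<lambda>x. f (c * x) / x) has_integral I) {u..v}"
proof -
  have "((\<lambda>x. f (c * x) / (c * x)) has_integral (1 / \<bar>c\<bar>) *\<^sub>R I) ((\<lambda>x. x / c) ` {c * u..c * v})"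
    by (rule has_integral_stretch_real[OF assms(1)]) (use assms in auto)
  moreover have "(\<lambda>x. x / c) ` {c * u..c * v} = {u..v}"
    using assms by (simp add: image_divide_atLeastAtMost)
  ultimately have "((\<lambda>x. c * (f (c * x) / (c * x))) has_integral c * (I / c)) {u..v}"
    using assms by (intro has_integral_mult_right) simp
  then show ?thesis using assms by simp
qed

text \<open>L is the limit at 0 and M acts as the mean at infinity. The order of p and q makes
  \<open>{p * u..q * u}\<close> a genuine interval; a reversed one would be empty and have integral
  0.\<close>

lemma frullani_le:
  fixes f :: "real \<Rightarrow> real"
  assumes int: "\<And>x y. f absolutely_integrable_on {x..y}"
    and L: "(f \<longlongrightarrow> L) (at_right 0)"
    and B: "\<And>x y. x \<le> y \<Longrightarrow> \<bar>integral {x..y} (\<lambda>t. f t - M)\<bar> \<le> B"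
    and "0 < p" "p \<le> q"
  shows "has_improper_integral_Ioi (\<lambda>x. (f (p * x) - f (q * x)) / x) ((L - M) * ln (q / p))"
proof -
  define h where "h = (\<lambda>t. f t / t)"
  have q: "0 < q" using assms by linarith
  have int': "f integrable_on {x..y}" for x y
    using int by (auto simp: absolutely_integrable_on_def)
  have absh: "h absolutely_integrable_on {u..v}" if "0 < u" for u v
    unfolding h_def by (rule absolutely_integrable_divide_Icc[OF int that])
  then have inth: "h integrable_on {u..v}" if "0 < u" for u v
    using that by (auto simp: absolutely_integrable_on_def)
  have scale: "((\<lambda>x. f (c * x) / x) has_integral integral {c * u..c * v} h) {u..v}"
    if "c > 0" "u > 0" for c u v
    by (rule has_integral_scale_divide) (use inth[of "c * u"] that in \<open>auto simp: h_def\<close>)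
  \<comment> \<open>The same scaling is applied to \<open>norm (f t)\<close>; on positive x dividing
    by x commutes with the norm.\<close>
  have abs_scale: "(\<lambda>x. f (c * x) / x) absolutely_integrable_on {u..v}" if "c > 0" "u > 0" for c u v
  proof -
    have "((\<lambda>x. norm (f (c * x)) / x) has_integral integral {c * u..c * v} (\<lambda>t. norm (f t) / t)) {u..v}"
    proof (rule has_integral_scale_divide)
      have "(\<lambda>t. norm (f t) / t) absolutely_integrable_on {c * u..c * v}"
        by (intro absolutely_integrable_divide_Icc absolutely_integrable_norm[unfolded o_def] int) (use that in auto)
      then show "((\<lambda>t. norm (f t) / t) has_integral integral {c * u..c * v} (\<lambda>t. norm (f t) / t)) {c * u..c * v}"
        by (auto simp: absolutely_integrable_on_def)
    qed (use that in auto)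
    then have "(\<lambda>x. norm (f (c * x) / x)) integrable_on {u..v}"
      by (rule integrable_eq[OF has_integral_integrable]) (use that in auto)
    then show ?thesis
      using scale[OF that] by (auto simp: absolutely_integrable_on_def)
  qed
  \<comment> \<open>Both scaled integrals are compared with the one over
    \<open>{p * \<epsilon>..q * R}\<close>, so \<open>q * \<epsilon>\<close> and
    \<open>p * R\<close> may come in either order.\<close>
  have split: "integral {\<epsilon>..R} (\<lambda>x. (f (p * x) - f (q * x)) / x)
      = integral {p * \<epsilon>..q * \<epsilon>} h - integral {p * R..q * R} h" if "0 < \<epsilon>" "\<epsilon> \<le> R" for \<epsilon> R
  proof -
    have "((\<lambda>x. f (p * x) / x - f (q * x) / x) has_integral
        integral {p * \<epsilon>..p * R} h - integral {q * \<epsilon>..q * R} h) {\<epsilon>..R}"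
      by (intro has_integral_diff scale) (use that assms q in auto)
    then have "integral {\<epsilon>..R} (\<lambda>x. (f (p * x) - f (q * x)) / x)
        = integral {p * \<epsilon>..p * R} h - integral {q * \<epsilon>..q * R} h"
      by (simp add: diff_divide_distrib integral_unique)
    moreover have "integral {p * \<epsilon>..p * R} h + integral {p * R..q * R} h = integral {p * \<epsilon>..q * R} h"
      by (rule Henstock_Kurzweil_Integration.integral_combine) (use that assms q inth in auto)
    moreover have "integral {p * \<epsilon>..q * \<epsilon>} h + integral {q * \<epsilon>..q * R} h = integral {p * \<epsilon>..q * R} h"
      by (rule Henstock_Kurzweil_Integration.integral_combine) (use that assms q inth in auto)
    ultimately show ?thesis by linarith
  qed
  \<comment> \<open>The integral of 1/t over \<open>{p * u..q * u}\<close> is ln (q / p) for every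
    u. This is used with K = L near 0 and K = M near infinity.\<close>
  have const: "integral {p * u..q * u} (\<lambda>t. (f t - K) / t) = integral {p * u..q * u} h - K * ln (q / p)"
    and const_int: "(\<lambda>t. (f t - K) / t) integrable_on {p * u..q * u}"
    if "u > 0" for u K
  proof -
    have "((\<lambda>t. h t - K * (1 / t)) has_integral integral {p * u..q * u} h - K * ln ((q * u) / (p * u))) {p * u..q * u}"
      by (intro has_integral_diff has_integral_mult_right has_integral_inverse_Icc)
         (use that assms inth[of "p * u"] in auto)
    moreover have "(\<lambda>t. h t - K * (1 / t)) = (\<lambda>t. (f t - K) / t)"
      by (auto simp: h_def diff_divide_distrib)
    ultimately have *: "((\<lambda>t. (f t - K) / t) has_integral integral {p * u..q * u} h - K * ln (q / p)) {p * u..q * u}"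
      using that by simp
    show "integral {p * u..q * u} (\<lambda>t. (f t - K) / t) = integral {p * u..q * u} h - K * ln (q / p)"
      using * by (rule integral_unique)
    show "(\<lambda>t. (f t - K) / t) integrable_on {p * u..q * u}"
      using * by (rule has_integral_integrable)
  qed
  have lim0: "((\<lambda>\<epsilon>. integral {p * \<epsilon>..q * \<epsilon>} h) \<longlongrightarrow> L * ln (q / p)) (at_right 0)"
  proof (rule tendstoI)
    fix e :: real assume "e > 0"
    \<comment> \<open>The added 1 keeps the denominator positive when p = q and makes d ln (q / p) <
      e strict.\<close>
    define d where "d = e / (ln (q / p) + 1)"
    have ln: "ln (q / p) \<ge> 0" using assms by simp
    then have d: "d > 0" "d * ln (q / p) < e"
      using \<open>e > 0\<close> by (auto simp: d_def field_simps)
    obtain b where b: "b > 0" "\<And>t. 0 < t \<Longrightarrow> t < b \<Longrightarrow> \<bar>f t - L\<bar> < d"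
      using tendstoD[OF L d(1)] unfolding eventually_at_right_field dist_real_def by auto
    \<comment> \<open>The bound b / q places \<open>{p * \<epsilon>..q * \<epsilon>}\<close> inside
      (0, b), where f is within d of L.\<close>
    have "dist (integral {p * \<epsilon>..q * \<epsilon>} h) (L * ln (q / p)) < e" if \<epsilon>: "0 < \<epsilon>" "\<epsilon> < b / q" for \<epsilon>
    proof -
      have "q * \<epsilon> < b" using \<epsilon> q by (simp add: field_simps)
      have "((\<lambda>t. d * (1 / t)) has_integral d * ln ((q * \<epsilon>) / (p * \<epsilon>))) {p * \<epsilon>..q * \<epsilon>}"
        by (intro has_integral_mult_right has_integral_inverse_Icc) (use \<epsilon> assms in auto)
      then have *: "((\<lambda>t. d * (1 / t)) has_integral d * ln (q / p)) {p * \<epsilon>..q * \<epsilon>}"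
        using \<epsilon> by simp
      have "norm (integral {p * \<epsilon>..q * \<epsilon>} (\<lambda>t. (f t - L) / t)) \<le> integral {p * \<epsilon>..q * \<epsilon>} (\<lambda>t. d * (1 / t))"
      proof (rule integral_norm_bound_integral)
        fix t assume t: "t \<in> {p * \<epsilon>..q * \<epsilon>}"
        have "0 < p * \<epsilon>" using \<epsilon> assms by simp
        then have "0 < t" "t < b" using t \<open>q * \<epsilon> < b\<close> by auto
        then show "norm ((f t - L) / t) \<le> d * (1 / t)"
          using b(2)[of t] by (simp add: divide_right_mono)
      qed (use const_int[OF \<epsilon>(1)] * in auto)
      also have "\<dots> = d * ln (q / p)" using * by (rule integral_unique)
      also note d(2)
      finally show ?thesis using const[OF \<epsilon>(1)] by (simp add: dist_real_def)
    qed
    moreover have "b / q > 0" using b q by simp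
    ultimately show "eventually (\<lambda>\<epsilon>. dist (integral {p * \<epsilon>..q * \<epsilon>} h) (L * ln (q / p)) < e) (at_right 0)"
      unfolding eventually_at_right_field by blast
  qed
  have limtop: "((\<lambda>R. integral {p * R..q * R} h) \<longlongrightarrow> M * ln (q / p)) at_top"
  proof -
    have "((\<lambda>R. integral {p * R..q * R} h - M * ln (q / p)) \<longlongrightarrow> 0) at_top"
    proof (rule Lim_null_comparison)
      show "eventually (\<lambda>R. norm (integral {p * R..q * R} h - M * ln (q / p)) \<le> 2 * B / (p * R)) at_top"
        using eventually_gt_at_top[of 0]
      proof eventually_elim
        case (elim R)
        have "\<bar>integral {p * R..q * R} (\<lambda>t. (f t - M) / t)\<bar> \<le> 2 * B / (p * R)"
          by (rule integral_divide_bound) (use elim assms int' in \<open>auto intro!: integrable_diff\<close>)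
        then show ?case using const[OF elim] by simp
      qed
      show "((\<lambda>R. 2 * B / (p * R)) \<longlongrightarrow> 0) at_top"
        using \<open>0 < p\<close> by real_asymp
    qed
    then show ?thesis by (rule LIM_zero_cancel)
  qed
  have "((\<lambda>z. integral {p * fst z..q * fst z} h - integral {p * snd z..q * snd z} h)
      \<longlongrightarrow> L * ln (q / p) - M * ln (q / p)) (at_right 0 \<times>\<^sub>F at_top)"
    by (intro tendsto_diff filterlim_compose[OF lim0 filterlim_fst]
        filterlim_compose[OF limtop filterlim_snd])
  moreover have "eventually (\<lambda>z. integral {p * fst z..q * fst z} h - integral {p * snd z..q * snd z} h
      = (case z of (\<epsilon>, R) \<Rightarrow> integral {\<epsilon>..R} (\<lambda>x. (f (p * x) - f (q * x)) / x))) (at_right 0 \<times>\<^sub>F at_top)"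
  proof -
    \<comment> \<open>Separating the two variables by 1 secures \<epsilon> \<le> R, as
      \<open>split\<close> requires, on a product of eventual sets.\<close>
    have "eventually (\<lambda>\<epsilon>::real. 0 < \<epsilon> \<and> \<epsilon> < 1) (at_right 0)"
      by (auto simp: eventually_at_right_field intro: exI[of _ 1])
    then have "eventually (\<lambda>z::real \<times> real. (0 < fst z \<and> fst z < 1) \<and> 1 \<le> snd z) (at_right 0 \<times>\<^sub>F at_top)"
      using eventually_prodI[OF _ eventually_ge_at_top[of "1::real"]] by fastforce
    then show ?thesis
      by eventually_elim (auto simp: split)
  qed
  ultimately have "((\<lambda>(\<epsilon>, R). integral {\<epsilon>..R} (\<lambda>x. (f (p * x) - f (q * x)) / x))
      \<longlongrightarrow> (L - M) * ln (q / p)) (at_right 0 \<times>\<^sub>F at_top)"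
    by (simp add: filterlim_cong left_diff_distrib)
  moreover have "(\<lambda>x. (f (p * x) - f (q * x)) / x) absolutely_integrable_on {\<epsilon>..R}" if "0 < \<epsilon>" for \<epsilon> R
    unfolding diff_divide_distrib
    by (intro set_integral_diff abs_scale) (use that assms q in auto)
  ultimately show ?thesis
    unfolding has_improper_integral_Ioi_def by blast
qed

text \<open>If q < p, exchanging p and q changes the sign of both the integrand and ln (q /
  p).\<close>

theorem frullani:
  fixes f :: "real \<Rightarrow> real"
  assumes "\<And>x y. f absolutely_integrable_on {x..y}"
    and "(f \<longlongrightarrow> L) (at_right 0)"
    and "\<And>x y. x \<le> y \<Longrightarrow> \<bar>integral {x..y} (\<lambda>t. f t - M)\<bar> \<le> B"
    and "0 < p" "0 < q"
  shows "has_improper_integral_Ioi (\<lambda>x. (f (p * x) - f (q * x)) / x) ((L - M) * ln (q / p))"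
proof (cases "p \<le> q")
  case True
  then show ?thesis using frullani_le assms by blast
next
  case False
  then have "has_improper_integral_Ioi (\<lambda>x. - ((f (q * x) - f (p * x)) / x)) (- ((L - M) * ln (p / q)))"
    using assms by (intro has_improper_integral_Ioi_uminus frullani_le) auto
  moreover have "(\<lambda>x. - ((f (q * x) - f (p * x)) / x)) = (\<lambda>x. (f (p * x) - f (q * x)) / x)"
    by (auto simp: diff_divide_distrib)
  moreover have "- ((L - M) * ln (p / q)) = (L - M) * ln (q / p)"
    using assms by (simp add: ln_div algebra_simps)
  ultimately show ?thesis by simp
qed

section \<open>Evaluation\<close>

text \<open>The mean M stays a parameter so that |a| \<le> 1 and |a| > 1 share one argument. The
  condition on a makes the kernel continuous at 0, with value ln ((1 + a)^2).\<close>

lemma log_cos_frullani: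
  assumes "a \<noteq> -1" "0 < p" "0 < q" and mean: "integral {0..2 * pi} (log_cos a) = 2 * pi * M"
  shows "has_improper_integral_Ioi (\<lambda>x. (log_cos a (p * x) - log_cos a (q * x)) / x)
           ((ln ((1 + a)\<^sup>2) - M) * ln (q / p))"
proof (rule frullani)
  have g: "(\<lambda>t. log_cos a t - M) absolutely_integrable_on {x..y}" for x y
    by (intro set_integral_diff log_cos_absolutely_integrable absolutely_integrable_on_const) auto
  have "((\<lambda>t. log_cos a t) \<longlongrightarrow> ln (1 + 2 * a * cos 0 + a\<^sup>2)) (at_right 0)"
    unfolding log_cos_def
  proof (intro tendsto_intros)
    have "(1 + a)\<^sup>2 \<noteq> 0" using assms by auto
    then show "1 + 2 * a * cos 0 + a\<^sup>2 \<noteq> 0"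
      by (simp add: power2_eq_square algebra_simps)
  qed
  then show "(log_cos a \<longlongrightarrow> ln ((1 + a)\<^sup>2)) (at_right 0)"
    by (simp add: power2_eq_square algebra_simps)
  have "integral {0..2 * pi} (\<lambda>t. log_cos a t - M) = 0"
    using mean log_cos_integrable by (subst Henstock_Kurzweil_Integration.integral_diff) auto
  then show "\<bar>integral {x..y} (\<lambda>t. log_cos a t - M)\<bar> \<le> integral {0..2 * pi} (\<lambda>t. \<bar>log_cos a t - M\<bar>)"
    if "x \<le> y" for x y
    using that g by (intro periodic_mean_zero_integral_bound) (auto simp: log_cos_periodic)
qed (use assms log_cos_absolutely_integrable in auto)

section \<open>Parameters of modulus greater than one\<close>

lemma log_cos_inverse:
  assumes "\<bar>a\<bar> > 1"
  shows "log_cos a t = ln (a\<^sup>2) + log_cos (1 / a) t"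
proof -
  have "1 + 2 * a * cos t + a\<^sup>2 = a\<^sup>2 * (1 + 2 * (1 / a) * cos t + (1 / a)\<^sup>2)"
    using assms by (simp add: power2_eq_square field_simps)
  moreover have "1 + 2 * (1 / a) * cos t + (1 / a)\<^sup>2 > 0"
    using assms by (intro log_cos_arg_pos) auto
  moreover have "a\<^sup>2 > 0" using assms by auto
  ultimately show ?thesis unfolding log_cos_def by (simp only: ln_mult_pos)
qed

lemma log_cos_integral_large:
  assumes "\<bar>a\<bar> > 1"
  shows "integral {0..2 * pi} (log_cos a) = 2 * pi * ln (a\<^sup>2)"
proof -
  have "log_cos a = (\<lambda>t. ln (a\<^sup>2) + log_cos (1 / a) t)"
    using log_cos_inverse[OF assms] by blast
  then have "integral {0..2 * pi} (log_cos a) = 2 * pi * ln (a\<^sup>2) + integral {0..2 * pi} (log_cos (1 / a))"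
    by (simp only: Henstock_Kurzweil_Integration.integral_add[OF integrable_const_ivl log_cos_integrable]) simp
  moreover have "\<bar>1 / a\<bar> \<le> 1" using assms by simp
  ultimately show ?thesis by (simp only: log_cos_integral_zero add_0_right)
qed

theorem mainTheorem1:
  fixes p q a :: real
  assumes "p > 0" and "q > 0" and "a \<noteq> -1"
  shows "(-1 < a \<and> a \<le> 1 \<longrightarrow>
            has_improper_integral_Ioi
              (\<lambda>x. (ln (1 + 2 * a * cos (p * x) + a\<^sup>2) - ln (1 + 2 * a * cos (q * x) + a\<^sup>2)) / x)
              (2 * ln (q / p) * ln (1 + a))) \<and>
         (a < -1 \<or> a \<ge> 1 \<longrightarrow>
            has_improper_integral_Ioi
              (\<lambda>x. (ln (1 + 2 * a * cos (p * x) + a\<^sup>2) - ln (1 + 2 * a * cos (q * x) + a\<^sup>2)) / x)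
              (2 * ln (q / p) * ln (1 + 1 / a)))"
proof -
  let ?thesis' = "\<lambda>c. has_improper_integral_Ioi
    (\<lambda>x. (ln (1 + 2 * a * cos (p * x) + a\<^sup>2) - ln (1 + 2 * a * cos (q * x) + a\<^sup>2)) / x)
    (2 * ln (q / p) * c)"
  have small: "?thesis' (ln (1 + a))" if "-1 < a" "a \<le> 1"
  proof -
    have "integral {0..2 * pi} (log_cos a) = 2 * pi * 0"
      using that by (simp add: log_cos_integral_zero)
    from log_cos_frullani[OF assms(3,1,2) this] that show ?thesis
      by (simp add: log_cos_def ln_realpow mult_ac)
  qed
  have large: "?thesis' (ln (1 + 1 / a))" if "\<bar>a\<bar> > 1"
  proof -
    \<comment> \<open>This holds also for a < -1, where 1 + a is negative; hence the square in ln
      ((1 + 1 / a)^2) can be taken out as the factor 2.\<close>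
    have pos: "1 + 1 / a > 0" using that by (auto simp: field_simps abs_if split: if_splits)
    have "(1 + a)\<^sup>2 = a\<^sup>2 * (1 + 1 / a)\<^sup>2"
      using that by (simp add: power2_eq_square field_simps)
    moreover have "a\<^sup>2 > 0" "(1 + 1 / a)\<^sup>2 > 0" using that pos by auto
    ultimately have "ln ((1 + a)\<^sup>2) - ln (a\<^sup>2) = ln ((1 + 1 / a)\<^sup>2)"
      by (simp only: ln_mult_pos)
    also have "\<dots> = 2 * ln (1 + 1 / a)" using pos by (simp add: ln_realpow)
    finally show ?thesis
      using log_cos_frullani[OF assms(3,1,2) log_cos_integral_large[OF that]]
      by (simp add: log_cos_def mult_ac)
  qed
  \<comment> \<open>At a = 1 the second value is the first, as 1 + 1 / a = 1 + a there; every other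
    a of the second case has |a| > 1.\<close>
  show ?thesis
    using small large by (cases "a = 1") (auto simp: abs_if)
qed

end
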